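(* In the two-slope ski rental problem with tail constraint $(\gamma,\delta)$ described in the context, every optimal solution $f$ satisfies $\alpha_f(1)=\mathrm{OPT}$ (the competitive ratio constraint is tight at time $1$).
   Context: Fix $0\le a<1$ and $(\gamma,\delta)$ with $2-a\le\gamma<1/a$, $0\le\delta\le1$. A purchase distribution $f$ is a probability distribution on $[0,\infty)\cup\{\infty\}$ (buying time; $\infty$ = never buy). For buying time $t$ and stopping time $x>0$: $\alpha(t,x)=\frac{t+1-a+a(x-t)}{x}$ if $t\le x\le1$; $1$ if $t>x$, $x\le1$; $\frac{t+1-a+a(x-t)}{1-a+ax}$ if $t\le x$, $x>1$; $\frac{x}{1-a+ax}$ if $t>x$, $x>1$ (incl. $t=\infty$); $\alpha(t,\infty)=1$ for finite $t$, $\alpha(\infty,\infty)=1/a$. $\alpha_f(x)=\mathbb{E}_{t\sim f}\alpha(t,x)$. Bad interval $I_\gamma(x)=\{t:\alpha(t,x)>\gamma\}$; $f$ feasible if $f(I_\gamma(x))\le\delta$ for all $x\in(0,\infty]$. $\mathrm{OPT}=\min_{f\text{ feasible}}\sup_x\alpha_f(x)$; an optimal solution is a feasible $f$ attaining it. *)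

theory Defs
  imports "HOL-Probability.Probability"
begin

text \<open>
  Buying times and stopping times range over \<^typ>\<open>ennreal\<close>, i.e. the extended half-line
  \<open>[0,\<infinity>]\<close>; a buying time \<open>\<infinity>\<close> means never buying. Slope \<open>a\<close>, tail threshold \<open>\<gamma>\<close> and tail
  probability \<open>\<delta>\<close> are real parameters. Ratios are only meaningful for stopping times \<open>x > 0\<close>,
  and all quantification over \<open>x\<close> below is restricted to \<open>{0<..}\<close>, which contains \<open>\<infinity>\<close>.
\<close>

text \<open>
  \<open>alpha a t x\<close> is \<open>\<alpha>(t,x)\<close>. In \<^typ>\<open>ennreal\<close>, \<open>1 / 0 = \<infinity>\<close>, so \<open>\<alpha>(\<infinity>,\<infinity>) = \<infinity>\<close> when \<open>a = 0\<close>.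
  In the branches where \<open>s\<close> is used, \<open>t \<le> x < \<infinity>\<close>, so \<open>s\<close> is the real value of \<open>t\<close>.
\<close>

definition alpha :: "real \<Rightarrow> ennreal \<Rightarrow> ennreal \<Rightarrow> ennreal" where
  "alpha a t x =
    (if x = \<infinity> then (if t = \<infinity> then 1 / ennreal a else 1)
     else let s = enn2real t; y = enn2real x in ennreal
      (if x \<le> 1
       then (if t \<le> x then (s + 1 - a + a * (y - s)) / y else 1)
       else (if t \<le> x then (s + 1 - a + a * (y - s)) / (1 - a + a * y)
             else y / (1 - a + a * y))))"

definition purchase_distribution :: "ennreal measure \<Rightarrow> bool" where
  "purchase_distribution f \<longleftrightarrow> prob_space f \<and> sets f = sets borel"

definition alpha_avg :: "real \<Rightarrow> ennreal measure \<Rightarrow> ennreal \<Rightarrow> ennreal" where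
  "alpha_avg a f x = (\<integral>\<^sup>+ t. alpha a t x \<partial>f)"

definition bad_interval :: "real \<Rightarrow> real \<Rightarrow> ennreal \<Rightarrow> ennreal set" where
  "bad_interval a \<gamma> x = {t. alpha a t x > ennreal \<gamma>}"

definition feasible :: "real \<Rightarrow> real \<Rightarrow> real \<Rightarrow> ennreal measure \<Rightarrow> bool" where
  "feasible a \<gamma> \<delta> f \<longleftrightarrow>
    purchase_distribution f \<and> (\<forall>x\<in>{0<..}. measure f (bad_interval a \<gamma> x) \<le> \<delta>)"

definition comp_ratio :: "real \<Rightarrow> ennreal measure \<Rightarrow> ennreal" where
  "comp_ratio a f = (SUP x\<in>{0<..}. alpha_avg a f x)"

text \<open>
  The minimum is written as an infimum; attainment is part of the notion of an optimal solution.
\<close>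

definition OPT :: "real \<Rightarrow> real \<Rightarrow> real \<Rightarrow> ennreal" where
  "OPT a \<gamma> \<delta> = (INF f\<in>{f. feasible a \<gamma> \<delta> f}. comp_ratio a f)"

definition optimal :: "real \<Rightarrow> real \<Rightarrow> real \<Rightarrow> ennreal measure \<Rightarrow> bool" where
  "optimal a \<gamma> \<delta> f \<longleftrightarrow> feasible a \<gamma> \<delta> f \<and> comp_ratio a f = OPT a \<gamma> \<delta>"

text \<open>The integrand is measurable, so the expectations and tail probabilities are genuine.\<close>

lemma alpha_measurable [measurable]: "(\<lambda>t. alpha a t x) \<in> borel_measurable borel"
  unfolding alpha_def Let_def by measurable

lemma bad_interval_borel [measurable]: "bad_interval a \<gamma> x \<in> sets borel"
proof -
  have "{t \<in> space borel. ennreal \<gamma> < alpha a t x} \<in> sets borel"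
    by measurable
  then show ?thesis by (simp add: bad_interval_def)
qed

end

theory Submission
  imports Defs
begin

text \<open>
  Write \<open>\<alpha>\<^sub>f(x) = 1 + (1 - a) R(x)\<close> and \<open>OPT = 1 + (1 - a) r\<close>. The functional \<open>R\<close> is linear in
  \<open>f\<close>, feasible distributions form a convex set, and since \<open>\<gamma> \<ge> 2 - a\<close> the buying time 1 is never
  bad, so moving mass to 1 preserves feasibility. Suppose \<open>R(1) < r\<close> for an optimal \<open>f\<close>, and call
  \<open>(1 - a + a x) (r - R(x))\<close> the slack at \<open>x \<ge> 1\<close>. If the slack is bounded away from 0 on \<open>[1,\<infinity>)\<close>,
  then mixing \<open>f\<close> with a little of the point mass at 1 beats \<open>r\<close> everywhere, because that point mass
  has \<open>R = 0\<close> before time 1. Otherwise there is a \<open>Y > 1\<close> such that \<open>f\<close> charges \<open>(1,Y]\<close> and the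
  slack is bounded away from 0 on \<open>[1,Y)\<close>. Moving a small fraction of the mass on \<open>(1,Y]\<close> to 1
  costs little slack on \<open>[1,Y)\<close>, gains a fixed amount on \<open>[Y,\<infinity>)\<close> and does not affect stopping
  times below 1, which reduces to the first case.
\<close>

section \<open>Mixtures of purchase distributions\<close>

text \<open>The mixture is drawn by first tossing a Bernoulli coin of bias \<open>e\<close> and then
  sampling from \<open>g\<close> or \<open>f\<close>. Only its integrals are exported;
  probabilities, feasibility and ratios are all derived from them.\<close>

lemma mixture_exists:
  assumes f: "purchase_distribution f" and g: "purchase_distribution g"
    and e: "0 \<le> e" "e \<le> 1"
  obtains h where "purchase_distribution h"
    and "\<And>\<phi>. \<phi> \<in> borel_measurable borel \<Longrightarrow>
      (\<integral>\<^sup>+t. \<phi> t \<partial>h) = ennreal (1 - e) * (\<integral>\<^sup>+t. \<phi> t \<partial>f) + ennreal e * (\<integral>\<^sup>+t. \<phi> t \<partial>g)"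
proof -
  interpret f: prob_space f using f by (simp add: purchase_distribution_def)
  interpret g: prob_space g using g by (simp add: purchase_distribution_def)
  have sf: "sets f = sets borel" and sg: "sets g = sets borel"
    using f g by (simp_all add: purchase_distribution_def)
  define N where "N b = (if b then g else f)" for b
  let ?h = "measure_pmf (bernoulli_pmf e) \<bind> N"
  have N: "N \<in> measurable (measure_pmf (bernoulli_pmf e)) (subprob_algebra borel)"
    by (auto simp: N_def space_subprob_algebra sf sg f.subprob_space_axioms g.subprob_space_axioms)
  have P: "prob_space (N b)" for b
    by (simp add: N_def f.prob_space_axioms g.prob_space_axioms)
  have "prob_space ?h"
    by (intro measure_pmf.prob_space_bind[OF _ N]) (simp add: P)
  moreover have "sets ?h = sets borel"
    by (subst sets_bind[where N=borel]) (auto simp: N_def sf sg)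
  ultimately have "purchase_distribution ?h" by (simp add: purchase_distribution_def)
  moreover have "(\<integral>\<^sup>+t. \<phi> t \<partial>?h) = ennreal (1 - e) * (\<integral>\<^sup>+t. \<phi> t \<partial>f) + ennreal e * (\<integral>\<^sup>+t. \<phi> t \<partial>g)"
    if "\<phi> \<in> borel_measurable borel" for \<phi>
    using e by (simp add: nn_integral_bind[OF that N] N_def ac_simps)
  ultimately show ?thesis using that by blast
qed

text \<open>The bound \<open>C\<close> makes \<psi> integrable under all three distributions, so the
  identity for nonnegative integrals passes to real ones. Indicators then give the rule for
  probabilities.\<close>

lemma integral_mixture:
  fixes \<psi> :: "ennreal \<Rightarrow> real"
  assumes f: "purchase_distribution f" and g: "purchase_distribution g"
    and h: "purchase_distribution h"
    and e: "0 \<le> e" "e \<le> 1"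
    and mix: "\<And>\<phi>. \<phi> \<in> borel_measurable borel \<Longrightarrow>
      (\<integral>\<^sup>+t. \<phi> t \<partial>h) = ennreal (1 - e) * (\<integral>\<^sup>+t. \<phi> t \<partial>f) + ennreal e * (\<integral>\<^sup>+t. \<phi> t \<partial>g)"
    and \<psi>: "\<psi> \<in> borel_measurable borel" "\<And>t. 0 \<le> \<psi> t" "\<And>t. \<psi> t \<le> C"
  shows "(\<integral>t. \<psi> t \<partial>h) = (1 - e) * (\<integral>t. \<psi> t \<partial>f) + e * (\<integral>t. \<psi> t \<partial>g)"
proof -
  have *: "(\<integral>\<^sup>+t. ennreal (\<psi> t) \<partial>M) = ennreal (\<integral>t. \<psi> t \<partial>M)" if "purchase_distribution M" for M
  proof -
    interpret prob_space M using that by (simp add: purchase_distribution_def)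
    have [measurable_cong]: "sets M = sets borel" using that by (simp add: purchase_distribution_def)
    note \<psi>(1)[measurable]
    have "integrable M \<psi>"
      by (rule integrable_const_bound[where B=C]) (use \<psi> in auto)
    then show ?thesis by (rule nn_integral_eq_integral) (use \<psi> in auto)
  qed
  have "ennreal (\<integral>t. \<psi> t \<partial>h) = ennreal ((1 - e) * (\<integral>t. \<psi> t \<partial>f) + e * (\<integral>t. \<psi> t \<partial>g))"
    using mix[of "\<lambda>t. ennreal (\<psi> t)"] \<psi>(1,2) e
    by (simp add: *[OF f] *[OF g] *[OF h] ennreal_mult ennreal_plus)
  then show ?thesis
    using e \<psi>(2) by (simp del: ennreal_plus add: add_nonneg_nonneg)
qed

section \<open>Feasibility: buying at time 1, moving mass there, convexity\<close>

lemma purchase_distribution_distr: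
  assumes "purchase_distribution f" "m \<in> borel_measurable borel"
  shows "purchase_distribution (distr f borel m)"
  using assms measurable_cong_sets[of f borel borel borel]
  by (auto simp: purchase_distribution_def intro!: prob_space.prob_space_distr)

text \<open>The worst stopping time for a purchase at 1 is 1 itself, with ratio
  \<open>2 - a\<close>: before it and at infinity the ratio is 1, and beyond it the numerator is at
  most \<open>2 - a\<close> times the denominator.\<close>

lemma alpha_one_le:
  assumes a: "0 \<le> a" "a < 1" and \<gamma>: "2 - a \<le> \<gamma>" and x: "0 < x"
  shows "alpha a 1 x \<le> ennreal \<gamma>"
proof (cases x)
  case (real y)
  have y: "0 < y" using x real by (metis ennreal_0 less_le not_less_iff_gr_or_eq)
  consider "y < 1" | "y = 1" | "y > 1" by linarith
  then show ?thesis
  proof cases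
    case 3
    have "0 \<le> (1 - a) * (a * (y - 1))" using a 3 by simp
    then have "(1 + 1 - a + a * (y - 1)) / (1 - a + a * y) \<le> 2 - a"
      using a y by (simp add: pos_divide_le_eq add_pos_nonneg) (simp add: algebra_simps)
    then show ?thesis using 3 real \<gamma> a
      by (simp add: alpha_def ennreal_leI del: ennreal_1 add: ennreal_1[symmetric])
  qed (use real \<gamma> a y in \<open>auto simp: alpha_def ennreal_leI simp del: ennreal_1 simp add: ennreal_1[symmetric]\<close>)
next
  case top
  then show ?thesis using \<gamma> a by (simp add: alpha_def flip: ennreal_1)
qed

lemma feasible_return_one:
  assumes "0 \<le> a" "a < 1" "2 - a \<le> \<gamma>" "0 \<le> \<delta>"
  shows "feasible a \<gamma> \<delta> (return borel 1)"
  using assms alpha_one_le[OF assms(1-3)]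
  by (auto simp: feasible_def purchase_distribution_def prob_space_return measure_return
      bad_interval_def indicator_def leD)

text \<open>As 1 is never bad, a point lands in a bad interval only if it stays put and was already
  in it, so no tail probability increases.\<close>

lemma feasible_move_to_one:
  assumes a: "0 \<le> a" "a < 1" "2 - a \<le> \<gamma>" and f: "feasible a \<gamma> \<delta> f"
    and B: "B \<in> sets borel"
  shows "feasible a \<gamma> \<delta> (distr f borel (\<lambda>t. if t \<in> B then 1 else t))"
proof -
  have pf: "purchase_distribution f" using f by (simp add: feasible_def)
  interpret prob_space f using pf by (simp add: purchase_distribution_def)
  have [measurable_cong]: "sets f = sets borel" using pf by (simp add: purchase_distribution_def)
  note B[measurable]
  show ?thesis
    unfolding feasible_def
  proof (intro conjI ballI)
    fix x :: ennreal assume x: "x \<in> {0<..}"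
    have "1 \<notin> bad_interval a \<gamma> x"
      using alpha_one_le[OF a, of x] x by (simp add: bad_interval_def leD)
    then have "prob ((\<lambda>t. if t \<in> B then 1 else t) -` bad_interval a \<gamma> x \<inter> space f)
        \<le> prob (bad_interval a \<gamma> x)"
      by (intro finite_measure_mono) (auto split: if_splits)
    also have "\<dots> \<le> \<delta>" using f x by (auto simp: feasible_def)
    finally show "measure (distr f borel (\<lambda>t. if t \<in> B then 1 else t)) (bad_interval a \<gamma> x) \<le> \<delta>"
      by (subst measure_distr) auto
  qed (auto intro!: purchase_distribution_distr pf)
qed

lemma feasible_mixture:
  assumes f: "feasible a \<gamma> \<delta> f" and g: "feasible a \<gamma> \<delta> g"
    and h: "purchase_distribution h" and e: "0 \<le> e" "e \<le> 1"
    and mix: "\<And>\<phi>. \<phi> \<in> borel_measurable borel \<Longrightarrow>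
      (\<integral>\<^sup>+t. \<phi> t \<partial>h) = ennreal (1 - e) * (\<integral>\<^sup>+t. \<phi> t \<partial>f) + ennreal e * (\<integral>\<^sup>+t. \<phi> t \<partial>g)"
  shows "feasible a \<gamma> \<delta> h"
proof -
  have pf: "purchase_distribution f" "purchase_distribution g" using f g by (auto simp: feasible_def)
  have *: "space M = UNIV" if "purchase_distribution M" for M
    using that sets_eq_imp_space_eq[of M borel] by (simp add: purchase_distribution_def)
  show ?thesis
    unfolding feasible_def
  proof (intro conjI ballI h)
    fix x :: ennreal assume x: "x \<in> {0<..}"
    let ?B = "bad_interval a \<gamma> x"
    have "measure h ?B = (1 - e) * measure f ?B + e * measure g ?B"
      using integral_mixture[OF pf h e mix, of "indicator ?B" 1]
      by (simp add: *[OF h] *[OF pf(1)] *[OF pf(2)])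
    also have "\<dots> \<le> (1 - e) * \<delta> + e * \<delta>"
      using f g x e by (intro add_mono mult_left_mono) (auto simp: feasible_def)
    finally show "measure h ?B \<le> \<delta>" by (simp add: algebra_simps)
  qed
qed

section \<open>The ratio in normalised form at finite stopping times\<close>

text \<open>This is (\<alpha> - 1) / (1 - a) at a finite stopping time; its expectation is the
  functional R. \<open>enn2real\<close> is applied only to finite \<open>t\<close>, so its default
  value at infinity never enters.\<close>

definition excess :: "real \<Rightarrow> ennreal \<Rightarrow> real \<Rightarrow> real" where
  "excess a t y =
    (if y \<le> 1 then (if t \<le> ennreal y then (1 + enn2real t - y) / y else 0)
     else (if t \<le> ennreal y then enn2real t else y - 1) / (1 - a + a * y))"

text \<open>For \<open>y\<close> at least 1 this is \<open>excess\<close> with the offline cost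
  \<open>1 - a + a * y\<close> cleared, so that slack is measured against an affine function of
  \<open>y\<close>.\<close>

definition late_cost :: "ennreal \<Rightarrow> real \<Rightarrow> real" where
  "late_cost t y = (if t \<le> ennreal y then enn2real t else y - 1)"

lemma excess_measurable [measurable]: "(\<lambda>t. excess a t y) \<in> borel_measurable borel"
  unfolding excess_def by measurable

lemma late_cost_measurable [measurable]: "(\<lambda>t. late_cost t y) \<in> borel_measurable borel"
  unfolding late_cost_def by measurable

lemma enn2real_le_real: "t \<le> ennreal y \<Longrightarrow> 0 \<le> y \<Longrightarrow> enn2real t \<le> y"
  by (metis enn2real_mono enn2real_ennreal ennreal_less_top)

lemma offline_cost_ge_one: "0 \<le> a \<Longrightarrow> 1 \<le> (y::real) \<Longrightarrow> 1 \<le> 1 - a + a * y"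
  by (simp add: mult_left_le mult_le_cancel_left1)

lemma late_cost_bounds: "1 \<le> y \<Longrightarrow> 0 \<le> late_cost t y" "1 \<le> y \<Longrightarrow> late_cost t y \<le> y"
  using enn2real_le_real[of t y] by (auto simp: late_cost_def)

lemma excess_eq_late_cost: "1 \<le> y \<Longrightarrow> excess a t y = late_cost t y / (1 - a + a * y)"
  by (cases "y = 1") (auto simp: excess_def late_cost_def)

text \<open>The upper bound is crude, \<open>1 / y\<close> serving \<open>y \<le> 1\<close> and
  \<open>y\<close> serving the rest; any bound uniform in \<open>t\<close> yields
  integrability.\<close>

lemma excess_bounds:
  assumes "0 \<le> a" "0 < y"
  shows "0 \<le> excess a t y" "excess a t y \<le> 1 / y + y"
proof -
  have "0 \<le> excess a t y \<and> excess a t y \<le> 1 / y + y"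
  proof (cases "y \<le> 1")
    case True
    have "(1 + enn2real t - y) / y \<le> 1 / y" if "t \<le> ennreal y"
      using assms that enn2real_le_real[of t y] by (intro divide_right_mono) auto
    moreover have "0 \<le> 1 + enn2real t - y" using True enn2real_nonneg[of t] by linarith
    ultimately show ?thesis using True assms by (auto simp: excess_def intro: add_increasing2)
  next
    case False
    then have "1 \<le> 1 - a + a * y" using offline_cost_ge_one assms by simp
    moreover have "late_cost t y / (1 - a + a * y) \<le> late_cost t y / 1"
      using False calculation late_cost_bounds[of y t] by (intro divide_left_mono) auto
    moreover have "y \<le> 1 / y + y" using assms by simp
    ultimately show ?thesis
      using False late_cost_bounds[of y t] order_trans[of "late_cost t y / (1 - a + a * y)" y "1 / y + y"]
      by (simp add: excess_eq_late_cost)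
  qed
  then show "0 \<le> excess a t y" "excess a t y \<le> 1 / y + y" by auto
qed

lemma alpha_eq_excess:
  assumes "0 \<le> a" "a < 1" "0 < y"
  shows "alpha a t (ennreal y) = ennreal (1 + (1 - a) * excess a t y)"
proof -
  have b: "0 < 1 - a + a * y" using assms by (simp add: add_pos_nonneg)
  have "(s + 1 - a + a * (y - s)) / y = 1 + (1 - a) * ((1 + s - y) / y)" for s
    using assms by (simp add: field_simps)
  moreover have "(s + 1 - a + a * (y - s)) / (1 - a + a * y) = 1 + (1 - a) * (s / (1 - a + a * y))" for s
    using b by (simp add: divide_simps) (simp add: algebra_simps)
  moreover have "y / (1 - a + a * y) = 1 + (1 - a) * ((y - 1) / (1 - a + a * y))"
    using b by (simp add: divide_simps) (simp add: algebra_simps)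
  ultimately show ?thesis using assms by (simp add: alpha_def excess_def Let_def)
qed

lemma integrable_bounded_purchase:
  fixes \<psi> :: "ennreal \<Rightarrow> real"
  assumes "purchase_distribution f" "\<psi> \<in> borel_measurable borel" "\<And>t. 0 \<le> \<psi> t" "\<And>t. \<psi> t \<le> C"
  shows "integrable f \<psi>"
proof -
  interpret prob_space f using assms by (simp add: purchase_distribution_def)
  have [measurable_cong]: "sets f = sets borel" using assms by (simp add: purchase_distribution_def)
  note assms(2)[measurable]
  show ?thesis by (rule integrable_const_bound[where B=C]) (use assms in auto)
qed

lemma integrable_excess:
  "purchase_distribution f \<Longrightarrow> 0 \<le> a \<Longrightarrow> 0 < y \<Longrightarrow> integrable f (\<lambda>t. excess a t y)"
  using excess_bounds[of a y] by (intro integrable_bounded_purchase[where C="1/y+y"]) auto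

lemma integrable_late_cost:
  "purchase_distribution f \<Longrightarrow> 1 \<le> y \<Longrightarrow> integrable f (\<lambda>t. late_cost t y)"
  using late_cost_bounds[of y] by (intro integrable_bounded_purchase[where C=y]) auto

lemma alpha_avg_eq_excess:
  assumes f: "purchase_distribution f" and a: "0 \<le> a" "a < 1" and y: "0 < y"
  shows "alpha_avg a f (ennreal y) = ennreal (1 + (1 - a) * (\<integral>t. excess a t y \<partial>f))"
proof -
  interpret prob_space f using f by (simp add: purchase_distribution_def)
  note i = integrable_excess[OF f a(1) y]
  have "alpha_avg a f (ennreal y) = (\<integral>\<^sup>+t. ennreal (1 + (1 - a) * excess a t y) \<partial>f)"
    by (simp add: alpha_avg_def alpha_eq_excess[OF a y])
  also have "\<dots> = ennreal (\<integral>t. 1 + (1 - a) * excess a t y \<partial>f)"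
    using i a excess_bounds[OF a(1) y] by (intro nn_integral_eq_integral) (auto intro!: add_nonneg_nonneg)
  also have "(\<integral>t. 1 + (1 - a) * excess a t y \<partial>f) = 1 + (1 - a) * (\<integral>t. excess a t y \<partial>f)"
    using i by (simp add: prob_space)
  finally show ?thesis .
qed


section \<open>Where the slack after time 1 can vanish\<close>

text \<open>The mass of \<open>(1,y]\<close> is nondecreasing and right-continuous in
  \<open>y\<close>, and zero for \<open>y \<le> 1\<close>. Hence the infimum of the points where it
  reaches \<theta> is attained and exceeds 1.\<close>

lemma first_threshold:
  fixes Y0 :: real
  assumes f: "purchase_distribution f" and \<theta>: "0 < \<theta>" "\<theta> \<le> measure f {1<..ennreal Y0}"
  obtains Y where "1 < Y" "Y \<le> Y0" "\<theta> \<le> measure f {1<..ennreal Y}"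
    "\<And>y. y < Y \<Longrightarrow> measure f {1<..ennreal y} < \<theta>"
proof -
  interpret prob_space f using f by (simp add: purchase_distribution_def)
  have sf: "sets f = sets borel" using f by (simp add: purchase_distribution_def)
  define q where "q y = prob {1<..ennreal y}" for y
  have q1: "q y = 0" if "y \<le> 1" for y
  proof -
    have "{1<..ennreal y} = {}" using that by (auto simp: not_less simp flip: ennreal_1 dest: order_trans[OF _ ennreal_leI])
    then show ?thesis by (simp add: q_def)
  qed
  define S where "S = {y. \<theta> \<le> q y}"
  have S1: "1 \<le> y" if "y \<in> S" for y
    using that \<theta>(1) q1[of y] by (cases "y \<le> 1") (auto simp: S_def)
  then have bdd: "bdd_below S" by (rule bdd_belowI)
  have ne: "Y0 \<in> S" using \<theta> by (simp add: S_def q_def)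
  define Y where "Y = Inf S"
  have mono: "q x \<le> q y" if "x \<le> y" for x y
    unfolding q_def using ennreal_leI[OF that] by (intro finite_measure_mono) (auto simp: sf)
  have above: "\<theta> \<le> q y" if "Y < y" for y
  proof -
    have "\<exists>x\<in>S. x < y"
      by (rule cInf_lessD) (use that ne in \<open>auto simp: Y_def\<close>)
    then obtain x where "x \<in> S" "x < y" by blast
    then have "\<theta> \<le> q x" "q x \<le> q y" using mono[of x y] by (auto simp: S_def)
    then show ?thesis by (rule order_trans)
  qed
  \<comment> \<open>The infimum gives the bound only strictly above \<open>Y\<close>; continuity
    from above along these intervals, closed on the right, carries it to \<open>Y\<close>.\<close>
  let ?A = "\<lambda>n. {1<..ennreal (Y + 1 / real (Suc n))}"
  have "(\<lambda>n. prob (?A n)) \<longlonglongrightarrow> prob (\<Inter>n. ?A n)"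
  proof (rule finite_Lim_measure_decseq[where A="?A"])
    have "Y + 1 / real (Suc n) \<le> Y + 1 / real (Suc m)" if "m \<le> n" for m n
      using that by (intro add_left_mono divide_left_mono) auto
    then have "ennreal (Y + 1 / real (Suc n)) \<le> ennreal (Y + 1 / real (Suc m))" if "m \<le> n" for m n
      using that by (intro ennreal_leI) blast
    then show "decseq ?A"
      unfolding decseq_def by (meson greaterThanAtMost_iff order_trans subsetI)
  qed (auto simp: sf)
  moreover have "(\<Inter>n. ?A n) = {1<..ennreal Y}"
  proof (intro equalityI subsetI)
    fix t assume t: "t \<in> (\<Inter>n. ?A n)"
    have "(\<lambda>n. Y + 1 / real (Suc n)) \<longlonglongrightarrow> Y + 0"
      by (intro tendsto_intros LIMSEQ_Suc[OF lim_1_over_n])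
    then have "(\<lambda>n. ennreal (Y + 1 / real (Suc n))) \<longlonglongrightarrow> ennreal Y"
      by (intro tendsto_ennrealI) simp
    then have "t \<le> ennreal Y" by (rule LIMSEQ_le_const) (use t in auto)
    then show "t \<in> {1<..ennreal Y}" using t by auto
  next
    fix t assume "t \<in> {1<..ennreal Y}"
    moreover have "ennreal Y \<le> ennreal (Y + 1 / real (Suc n))" for n by (intro ennreal_leI) simp
    ultimately show "t \<in> (\<Inter>n. ?A n)" by (auto intro: order_trans)
  qed
  ultimately have "(\<lambda>n. q (Y + 1 / real (Suc n))) \<longlonglongrightarrow> q Y" by (simp add: q_def)
  then have qY: "\<theta> \<le> q Y"
    by (rule LIMSEQ_le_const) (auto intro!: above)
  show ?thesis
  proof
    show "1 < Y" using qY q1[of Y] \<theta>(1) by (auto simp: not_le[symmetric])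
    show "Y \<le> Y0" unfolding Y_def using ne bdd by (rule cInf_lower)
    show "\<theta> \<le> prob {1<..ennreal Y}" using qY by (simp add: q_def)
    show "prob {1<..ennreal y} < \<theta>" if "y < Y" for y
      using that cInf_lower[OF _ bdd, of y] by (auto simp: S_def q_def Y_def not_le[symmetric])
  qed
qed

text \<open>The offline cost is 1 at \<open>y = 1\<close>, so \<open>N1\<close> says that the slack
  there is strictly positive, while \<open>N\<close> makes it nonnegative later. The case
  \<open>mass\<close> provides the \<open>Y\<close> at which mass can profitably be moved.\<close>

lemma slack_before_late_mass:
  fixes r :: real
  assumes f: "purchase_distribution f" and a: "0 \<le> a" "a < 1"
    and N: "\<And>y. 1 \<le> y \<Longrightarrow> (\<integral>t. late_cost t y \<partial>f) \<le> r * (1 - a + a * y)"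
    and N1: "(\<integral>t. late_cost t 1 \<partial>f) < r"
  obtains (slack) c where "0 < c" "\<And>y. 1 \<le> y \<Longrightarrow> (\<integral>t. late_cost t y \<partial>f) \<le> r * (1 - a + a * y) - c"
  | (mass) Y c where "1 < Y" "0 < measure f {1<..ennreal Y}" "0 < c"
      "\<And>y. 1 \<le> y \<Longrightarrow> y < Y \<Longrightarrow> (\<integral>t. late_cost t y \<partial>f) \<le> r * (1 - a + a * y) - c"
proof -
  interpret prob_space f using f by (simp add: purchase_distribution_def)
  have sf[measurable_cong]: "sets f = sets borel" using f by (simp add: purchase_distribution_def)
  \<comment> \<open>\<open>L y - q y\<close> bounds the slack at \<open>y\<close> from below; \<open>L\<close> is affine with \<open>L 1 > 0\<close>, and if it has a
    zero, then some mass lies in \<open>(1,\<infinity>)\<close> before that zero, since otherwise the slack would be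
    negative right after it.\<close>
  define p where "p = prob {1<..}"
  define q where "q y = prob {1<..ennreal y}" for y
  define m where "m = (\<integral>t. late_cost t 1 \<partial>f)"
  define L where "L y = r * (1 - a + a * y) - m - (y - 1) * p" for y
  note int = integrable_late_cost[OF f]
  have ind: "integrable f (\<lambda>t. indicator A t :: real)" if "A \<in> sets borel" for A :: "ennreal set"
    using that by (intro integrable_bounded_purchase[OF f, where C=1]) (auto simp: indicator_def)
  have E: "(\<integral>t. late_cost t 1 + (y - 1) * indicator {1<..} t \<partial>f) = m + (y - 1) * p" for y
    using int[of 1] ind[of "{1<..}"] by (simp add: m_def p_def sets_eq_imp_space_eq[OF sf])
  have upper: "(\<integral>t. late_cost t y \<partial>f) \<le> r * (1 - a + a * y) - (L y - q y)" if y: "1 \<le> y" for y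
  proof -
    \<comment> \<open>The first two terms treat every \<open>t > 1\<close> as not yet bought at
      \<open>y\<close>, at cost \<open>y - 1\<close>. A purchase in \<open>(1,y]\<close> costs
      \<open>t \<le> y\<close>, at most 1 more.\<close>
    have "late_cost t y \<le> late_cost t 1 + (y - 1) * indicator {1<..} t + indicator {1<..ennreal y} t" for t
      using y enn2real_le_real[of t y] order_trans[of t 1 "ennreal y"]
      by (auto simp: late_cost_def indicator_def simp flip: ennreal_1)
    then have "(\<integral>t. late_cost t y \<partial>f)
        \<le> (\<integral>t. late_cost t 1 + (y - 1) * indicator {1<..} t + indicator {1<..ennreal y} t \<partial>f)"
      using int[of 1] ind int[OF y] by (intro integral_mono) auto
    also have "\<dots> = m + (y - 1) * p + q y"
      using int[of 1] ind E[of y] by (subst Bochner_Integration.integral_add)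
        (auto simp: q_def sets_eq_imp_space_eq[OF sf])
    finally show ?thesis by (simp add: L_def)
  qed
  \<comment> \<open>Almost every purchase after 1 now comes after \<open>z\<close>, and if made by
    \<open>y\<close> it costs at least \<open>z \<ge> y - 1\<close>. Treating it as not bought
    therefore underestimates the cost, and \<open>N\<close> applies without the error
    \<open>q y\<close>.\<close>
  have lower: "0 \<le> L y" if z: "1 \<le> z" "z \<le> y" "y \<le> z + 1" "q z = 0" for y z
  proof -
    have "AE t in f. t \<notin> {1<..ennreal z}"
      using z by (intro AE_I[where N="{1<..ennreal z}"]) (auto simp: q_def emeasure_eq_measure sf)
    then have "AE t in f. late_cost t 1 + (y - 1) * indicator {1<..} t \<le> late_cost t y"
    proof eventually_elim
      case (elim t)
      show ?case
      proof (cases "t \<le> 1")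
        case True
        moreover have "t \<le> ennreal y" using True z by (metis ennreal_1 ennreal_leI order_trans)
        ultimately show ?thesis by (simp add: late_cost_def)
      next
        case False
        then have "ennreal z < t" using elim by auto
        then have "z \<le> enn2real t" if "t \<le> ennreal y"
          using that z by (cases t) (auto simp: top_unique ennreal_less_iff)
        then show ?thesis using False z by (auto simp: late_cost_def)
      qed
    qed
    then have "m + (y - 1) * p \<le> (\<integral>t. late_cost t y \<partial>f)"
      unfolding E[symmetric] using int[of 1] int[of y] ind z by (intro integral_mono_AE) auto
    also have "\<dots> \<le> r * (1 - a + a * y)" using z by (intro N) simp
    finally show ?thesis by (simp add: L_def)
  qed
  have L_eq: "L y = (r - m) + (r * a - p) * (y - 1)" for y
    by (simp add: L_def algebra_simps)
  have d: "0 < r - m" using N1 by (simp add: m_def)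
  have "(\<exists>c>0. \<forall>y\<ge>1. c \<le> L y - q y) \<or> (\<exists>Y0 D. 0 < q Y0 \<and> 0 < D \<and> (\<forall>y. 1 \<le> y \<longrightarrow> y \<le> Y0 \<longrightarrow> D \<le> L y))"
  proof (cases "p \<le> r * a")
    case True
    then have L: "r - m \<le> L y" if "1 \<le> y" for y using that by (simp add: L_eq)
    show ?thesis
    proof (cases "\<exists>Y0. 0 < q Y0")
      case True then show ?thesis using L d by blast
    next
      case False
      then have "q y = 0" for y using measure_nonneg[of f "{1<..ennreal y}"] by (metis less_le q_def)
      then show ?thesis using L d by (intro disjI1 exI[of _ "r - m"]) auto
    qed
  next
    case False
    \<comment> \<open>The slope \<open>r * a - p\<close> of \<open>L\<close> is negative here, and
      \<open>y0\<close> is its zero.\<close>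
    define y0 where "y0 = 1 + (r - m) / (p - r * a)"
    have y0: "1 < y0" "L y = (p - r * a) * (y0 - y)" for y
      using False d by (auto simp: y0_def L_eq field_simps)
    have "\<exists>z. 1 \<le> z \<and> z < y0 \<and> 0 < q z"
    proof (rule ccontr)
      assume no: "\<not> ?thesis"
      \<comment> \<open>Being this close to \<open>y0\<close> leaves room for the test point
        \<open>y0 + 1/2\<close>, where \<open>L\<close> is negative, inside the window
        \<open>[z, z + 1]\<close> of \<open>lower\<close>.\<close>
      define z where "z = max 1 (y0 - 1 / 4)"
      have z: "1 \<le> z" "z < y0" "y0 + 1/2 \<le> z + 1" using y0(1) by (auto simp: z_def)
      moreover have "q z = 0" using no z measure_nonneg[of f "{1<..ennreal z}"] by (auto simp: q_def less_le)
      ultimately have "0 \<le> L (y0 + 1/2)" by (intro lower[of z]) auto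
      then show False using False by (simp add: y0(2))
    qed
    then obtain z where z: "1 \<le> z" "z < y0" "0 < q z" by blast
    have "0 < L z" using z False by (simp add: y0(2))
    moreover have "L z \<le> L y" if "y \<le> z" for y using that False by (simp add: y0(2))
    ultimately show ?thesis using z by blast
  qed
  then show ?thesis
  proof (elim disjE exE conjE)
    fix c assume c: "0 < c" "\<forall>y\<ge>1. c \<le> L y - q y"
    show ?thesis
      using c(1)
    proof (rule slack)
      show "(\<integral>t. late_cost t y \<partial>f) \<le> r * (1 - a + a * y) - c" if "1 \<le> y" for y
        using upper[OF that] c(2) that by (smt (verit))
    qed
  next
    fix Y0 D assume D: "0 < q Y0" "0 < D" and L: "\<forall>y. 1 \<le> y \<longrightarrow> y \<le> Y0 \<longrightarrow> D \<le> L y"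
    \<comment> \<open>The bound \<open>D / 2\<close> keeps half of \<open>D\<close> as slack before
      \<open>Y\<close>; the bound \<open>q Y0\<close> guarantees that the threshold is reached by
      \<open>Y0\<close>, up to where \<open>D \<le> L y\<close> is known.\<close>
    have "0 < min (D / 2) (q Y0)" "min (D / 2) (q Y0) \<le> measure f {1<..ennreal Y0}"
      using D by (auto simp: q_def)
    from first_threshold[OF f this] obtain Y where Y: "1 < Y" "Y \<le> Y0"
      "min (D / 2) (q Y0) \<le> q Y" "\<And>y. y < Y \<Longrightarrow> q y < min (D / 2) (q Y0)"
      by (auto simp: q_def)
    show ?thesis
    proof (rule mass)
      show "0 < measure f {1<..ennreal Y}" using Y(3) D by (auto simp: q_def)
      show "(\<integral>t. late_cost t y \<partial>f) \<le> r * (1 - a + a * y) - D / 2" if "1 \<le> y" "y < Y" for y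
      proof -
        have "D \<le> L y" "q y < D / 2" using L that Y(2) Y(4)[of y] by auto
        then show ?thesis using upper[OF that(1)] by linarith
      qed
    qed (use Y D in auto)
  qed
qed

section \<open>Moving late mass to time 1\<close>

text \<open>If the slack is already uniform, \<open>g\<close> is \<open>f\<close>; otherwise
  \<open>g\<close> mixes \<open>f\<close> with its image under moving \<open>(1,Y]\<close> to 1.
  Stopping times below 1 cannot distinguish purchases at 1 or later, and finite purchases stay
  finite, which gives the last two conclusions.\<close>

lemma slack_after_moving_late_mass:
  fixes r :: real
  assumes f: "feasible a \<gamma> \<delta> f" and a: "0 \<le> a" "a < 1" "2 - a \<le> \<gamma>"
    and N: "\<And>y. 1 \<le> y \<Longrightarrow> (\<integral>t. late_cost t y \<partial>f) \<le> r * (1 - a + a * y)"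
    and N1: "(\<integral>t. late_cost t 1 \<partial>f) < r"
  obtains g c where "feasible a \<gamma> \<delta> g" "0 < c"
    "\<And>y. 1 \<le> y \<Longrightarrow> (\<integral>t. late_cost t y \<partial>g) \<le> r * (1 - a + a * y) - c"
    "\<And>y. 0 < y \<Longrightarrow> y < 1 \<Longrightarrow> (\<integral>t. excess a t y \<partial>g) = (\<integral>t. excess a t y \<partial>f)"
    "alpha_avg a g \<infinity> \<le> alpha_avg a f \<infinity>"
proof -
  have pf: "purchase_distribution f" using f by (simp add: feasible_def)
  interpret prob_space f using pf by (simp add: purchase_distribution_def)
  have sf[measurable_cong]: "sets f = sets borel" using pf by (simp add: purchase_distribution_def)
  consider (slack) c where "0 < c" "\<And>y. 1 \<le> y \<Longrightarrow> (\<integral>t. late_cost t y \<partial>f) \<le> r * (1 - a + a * y) - c"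
    | (mass) Y c where "1 < Y" "0 < measure f {1<..ennreal Y}" "0 < c"
      "\<And>y. 1 \<le> y \<Longrightarrow> y < Y \<Longrightarrow> (\<integral>t. late_cost t y \<partial>f) \<le> r * (1 - a + a * y) - c"
    by (rule slack_before_late_mass[OF pf a(1,2) N N1]) (assumption | blast)+
  then show ?thesis
  proof cases
    case (slack c)
    then show ?thesis using that[OF f] by blast
  next
    case (mass Y c)
    let ?B = "{1<..ennreal Y}"
    define h where "h = distr f borel (\<lambda>t. if t \<in> ?B then 1 else t)"
    have m[measurable]: "(\<lambda>t. if t \<in> ?B then 1 else t) \<in> borel_measurable borel" by measurable
    have fh: "feasible a \<gamma> \<delta> h"
      unfolding h_def by (intro feasible_move_to_one a f) auto
    then have ph: "purchase_distribution h" by (simp add: feasible_def)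
    \<comment> \<open>Moving all of the mass raises the expected cost by at most 1, so moving the
      fraction \<open>e \<le> c / 2\<close> spends at most half of the slack \<open>c\<close> before
      \<open>Y\<close>.\<close>
    define e where "e = min 1 (c / 2)"
    have e: "0 < e" "e \<le> 1" "e \<le> c / 2" using mass by (auto simp: e_def)
    obtain g where g: "purchase_distribution g" and mix: "\<And>\<phi>. \<phi> \<in> borel_measurable borel \<Longrightarrow>
      (\<integral>\<^sup>+t. \<phi> t \<partial>g) = ennreal (1 - e) * (\<integral>\<^sup>+t. \<phi> t \<partial>f) + ennreal e * (\<integral>\<^sup>+t. \<phi> t \<partial>h)"
      using mixture_exists[OF pf ph, of e] e by auto
    have h_int: "(\<integral>t. \<psi> t \<partial>h) = (\<integral>t. \<psi> (if t \<in> ?B then 1 else t) \<partial>f)"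
      if "\<psi> \<in> borel_measurable borel" for \<psi> :: "ennreal \<Rightarrow> real"
      unfolding h_def using that by (intro integral_distr) auto
    have Ng: "(\<integral>t. late_cost t y \<partial>g) = (1 - e) * (\<integral>t. late_cost t y \<partial>f) + e * (\<integral>t. late_cost t y \<partial>h)"
      if "1 \<le> y" for y
      using e late_cost_bounds[OF that] by (intro integral_mixture[OF pf ph g _ _ mix, where C=y]) auto
    \<comment> \<open>From \<open>Y\<close> on, a moved purchase costs 1 instead of
      \<open>t\<close>. This saving does not depend on \<open>y\<close>, and it is positive on the
      whole of \<open>?B\<close>, which has positive mass.\<close>
    define gain where "gain t = indicator ?B t * (enn2real t - 1)" for t
    have "1 \<le> enn2real t" if "t \<in> ?B" for t
      using that by (cases t) (auto simp: top_unique ennreal_less_iff simp flip: ennreal_1)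
    then have gain_nonneg: "0 \<le> gain t" and gain_le: "gain t \<le> Y" for t
      using enn2real_le_real[of t Y] mass(1) by (auto simp: gain_def indicator_def)
    have gm[measurable]: "gain \<in> borel_measurable borel" unfolding gain_def[abs_def] by measurable
    have gi: "integrable f gain" using gain_nonneg gain_le gm by (intro integrable_bounded_purchase[OF pf]) auto
    define E where "E = (\<integral>t. gain t \<partial>f)"
    have "0 < E"
    proof (rule ccontr)
      assume "\<not> 0 < E"
      then have "E = 0" using gain_nonneg by (simp add: E_def integral_nonneg order_antisym not_less)
      then have "AE t in f. gain t = 0"
        using integral_nonneg_eq_0_iff_AE[OF gi] gain_nonneg by (simp add: E_def)
      then have "AE t in f. t \<notin> ?B"
      proof eventually_elim
        case (elim t)
        then show ?case by (cases t) (auto simp: gain_def indicator_def ennreal_less_iff top_unique simp flip: ennreal_1)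
      qed
      then have "prob ?B = 0" by (subst (asm) AE_iff_measurable[where N="?B"]) (auto simp: measure_def sf sets_eq_imp_space_eq[OF sf])
      then show False using mass(2) by simp
    qed
    have late1: "late_cost 1 y = 1" if "1 \<le> y" for y
      using that by (simp add: late_cost_def flip: ennreal_1)
    have early: "(\<integral>t. late_cost t y \<partial>h) \<le> (\<integral>t. late_cost t y \<partial>f) + 1" if y: "1 \<le> y" for y
    proof -
      have "(\<integral>t. late_cost t y \<partial>h) \<le> (\<integral>t. late_cost t y + 1 \<partial>f)"
        unfolding h_int[OF late_cost_measurable]
      proof (rule integral_mono)
        show "integrable f (\<lambda>t. late_cost (if t \<in> ?B then 1 else t) y)"
          using late_cost_bounds[OF y] by (intro integrable_bounded_purchase[OF pf, where C=y]) auto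
        show "integrable f (\<lambda>t. late_cost t y + 1)" using integrable_late_cost[OF pf y] by simp
        show "late_cost (if t \<in> ?B then 1 else t) y \<le> late_cost t y + 1" for t
          using late1[OF y] late_cost_bounds[OF y] by auto
      qed
      also have "\<dots> = (\<integral>t. late_cost t y \<partial>f) + 1"
        using integrable_late_cost[OF pf y] by (simp add: prob_space)
      finally show ?thesis .
    qed
    have late: "(\<integral>t. late_cost t y \<partial>h) = (\<integral>t. late_cost t y \<partial>f) - E" if y: "Y \<le> y" for y
    proof -
      have y1: "1 \<le> y" using y mass(1) by simp
      have "late_cost (if t \<in> ?B then 1 else t) y = late_cost t y - gain t" for t
      proof (cases "t \<in> ?B")
        case True
        then have "t \<le> ennreal y" using y by (auto intro: order_trans ennreal_leI)
        then show ?thesis using True late1[OF y1] by (simp add: gain_def) (simp add: late_cost_def)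
      qed (auto simp: gain_def)
      then show ?thesis
        using integrable_late_cost[OF pf y1] gi by (simp add: h_int E_def)
    qed
    show ?thesis
    proof (rule that)
      show "feasible a \<gamma> \<delta> g" using e by (intro feasible_mixture[OF f fh g _ _ mix]) auto
      show "0 < min (c / 2) (e * E)" using mass e \<open>0 < E\<close> by simp
      show "(\<integral>t. late_cost t y \<partial>g) \<le> r * (1 - a + a * y) - min (c / 2) (e * E)" if y: "1 \<le> y" for y
      proof (cases "y < Y")
        case True
        have "(\<integral>t. late_cost t y \<partial>g) \<le> (1 - e) * (\<integral>t. late_cost t y \<partial>f) + e * ((\<integral>t. late_cost t y \<partial>f) + 1)"
          unfolding Ng[OF y] using early[OF y] e by (intro add_mono mult_left_mono) auto
        also have "\<dots> = (\<integral>t. late_cost t y \<partial>f) + e" by (simp add: algebra_simps)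
        finally show ?thesis using mass(4)[OF y True] e by linarith
      next
        case False
        then have "(\<integral>t. late_cost t y \<partial>g) = (\<integral>t. late_cost t y \<partial>f) - e * E"
          by (simp add: Ng[OF y] late algebra_simps)
        then show ?thesis using N[OF y] by linarith
      qed
      show "(\<integral>t. excess a t y \<partial>g) = (\<integral>t. excess a t y \<partial>f)" if y: "0 < y" "y < 1" for y
      proof -
        have "excess a (if t \<in> ?B then 1 else t) y = excess a t y" for t
        proof -
          have "\<not> 1 \<le> ennreal y" using y by (simp flip: ennreal_1 add: ennreal_le_iff)
          moreover from this have "\<not> t \<le> ennreal y" if "t \<in> ?B"
            using that by (meson greaterThanAtMost_iff less_imp_le order_trans)
          ultimately show ?thesis using y by (auto simp: excess_def)
        qed
        then have "(\<integral>t. excess a t y \<partial>h) = (\<integral>t. excess a t y \<partial>f)" by (simp add: h_int)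
        moreover have "(\<integral>t. excess a t y \<partial>g) = (1 - e) * (\<integral>t. excess a t y \<partial>f) + e * (\<integral>t. excess a t y \<partial>h)"
          using e excess_bounds[OF a(1) y(1)]
          by (intro integral_mixture[OF pf ph g _ _ mix, where C="1/y+y"]) auto
        ultimately show ?thesis by (simp add: algebra_simps)
      qed
      show "alpha_avg a g \<infinity> \<le> alpha_avg a f \<infinity>"
      proof -
        have "alpha a (if t \<in> ?B then 1 else t) \<infinity> = alpha a t \<infinity>" for t
          by (auto simp: alpha_def top_unique)
        then have "alpha_avg a h \<infinity> = alpha_avg a f \<infinity>"
          unfolding alpha_avg_def h_def by (subst nn_integral_distr) auto
        then have "alpha_avg a g \<infinity> = ennreal (1 - e) * alpha_avg a f \<infinity> + ennreal e * alpha_avg a f \<infinity>"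
          by (simp add: alpha_avg_def mix)
        also have "\<dots> = alpha_avg a f \<infinity>"
          using e by (simp flip: distrib_right ennreal_plus)
        finally show ?thesis by simp
      qed
    qed
  qed
qed

section \<open>Beating the optimum with a point mass at time 1\<close>

theorem theorem8:
  fixes a \<gamma> \<delta> :: real and f :: "ennreal measure"
  assumes "0 \<le> a" and "a < 1"
    and "2 - a \<le> \<gamma>" and "ennreal \<gamma> < 1 / ennreal a"
    and "0 \<le> \<delta>" and "\<delta> \<le> 1"
    and "optimal a \<gamma> \<delta> f"
  shows "alpha_avg a f 1 = OPT a \<gamma> \<delta>"
proof (rule ccontr)
  assume ne: "alpha_avg a f 1 \<noteq> OPT a \<gamma> \<delta>"
  note a = assms(1,2)
  have f: "feasible a \<gamma> \<delta> f" and opt: "comp_ratio a f = OPT a \<gamma> \<delta>"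
    using assms(7) by (auto simp: optimal_def)
  have pf: "purchase_distribution f" using f by (simp add: feasible_def)
  have best: "OPT a \<gamma> \<delta> \<le> comp_ratio a g" if "feasible a \<gamma> \<delta> g" for g
    unfolding OPT_def using that by (intro INF_lower) simp
  have avg_le: "alpha_avg a f x \<le> OPT a \<gamma> \<delta>" if "0 < x" for x
    unfolding opt[symmetric] comp_ratio_def using that by (intro SUP_upper) simp
  \<comment> \<open>As a feasible competitor with ratio at most \<gamma>, it also shows that OPT is
    finite, so that a real \<open>r\<close> can encode it.\<close>
  let ?d = "return borel 1 :: ennreal measure"
  have fd: "feasible a \<gamma> \<delta> ?d" using assms by (intro feasible_return_one) auto
  then have pd: "purchase_distribution ?d" by (simp add: feasible_def)
  have "comp_ratio a ?d \<le> ennreal \<gamma>"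
    unfolding comp_ratio_def alpha_avg_def
    using alpha_one_le[OF assms(1-3)] by (intro SUP_least) (simp add: nn_integral_return)
  then have fin: "OPT a \<gamma> \<delta> < \<top>"
    using best[OF fd] by (meson ennreal_less_top le_less_trans)
  define r where "r = (enn2real (OPT a \<gamma> \<delta>) - 1) / (1 - a)"
  have "1 + (1 - a) * r = enn2real (OPT a \<gamma> \<delta>)" using a by (simp add: r_def)
  then have V: "OPT a \<gamma> \<delta> = ennreal (1 + (1 - a) * r)" and V0: "0 \<le> 1 + (1 - a) * r" using fin by auto
  have avg: "alpha_avg a g (ennreal y) = ennreal (1 + (1 - a) * (\<integral>t. excess a t y \<partial>g))"
    and nonneg: "0 \<le> (\<integral>t. excess a t y \<partial>g)"
    if "purchase_distribution g" "0 < y" for g y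
    by (rule alpha_avg_eq_excess[OF that(1) a that(2)]) (simp add: integral_nonneg excess_bounds[OF a(1) that(2)])
  have R: "(\<integral>t. excess a t y \<partial>f) \<le> r" if "0 < y" for y
    using avg_le[of "ennreal y"] avg[OF pf that] that V V0 a by simp
  have late: "(\<integral>t. late_cost t y \<partial>g) = (1 - a + a * y) * (\<integral>t. excess a t y \<partial>g)" if "1 \<le> y" for g y
    using offline_cost_ge_one[OF a(1) that] by (simp add: excess_eq_late_cost[OF that])
  have "(\<integral>t. late_cost t y \<partial>f) \<le> r * (1 - a + a * y)" if "1 \<le> y" for y
    unfolding late[OF that] using R[of y] that offline_cost_ge_one[OF a(1) that] by (simp add: mult.commute mult_left_mono)
  moreover have R1: "(\<integral>t. late_cost t 1 \<partial>f) < r"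
  proof -
    have "(\<integral>t. excess a t 1 \<partial>f) \<noteq> r" using ne avg[OF pf, of 1] V by auto
    then show ?thesis using R[of 1] by (simp add: late)
  qed
  ultimately obtain g c where g: "feasible a \<gamma> \<delta> g" "0 < c"
    "\<And>y. 1 \<le> y \<Longrightarrow> (\<integral>t. late_cost t y \<partial>g) \<le> r * (1 - a + a * y) - c"
    "\<And>y. 0 < y \<Longrightarrow> y < 1 \<Longrightarrow> (\<integral>t. excess a t y \<partial>g) = (\<integral>t. excess a t y \<partial>f)"
    "alpha_avg a g \<infinity> \<le> alpha_avg a f \<infinity>"
    using slack_after_moving_late_mass[OF f assms(1-3)] by metis
  have pg: "purchase_distribution g" using g(1) by (simp add: feasible_def)
  \<comment> \<open>Positivity makes \<open>(1 - k) * r\<close> strictly smaller than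
    \<open>r\<close>, which is the final contradiction.\<close>
  have r: "0 < r" using R1 nonneg[OF pf, of 1] by (simp add: late)
  \<comment> \<open>This solves \<open>k = (1 - k) * c\<close>: after time 1 the point mass has late
    cost 1, and its share \<open>k\<close> is paid exactly by the retained slack
    \<open>(1 - k) * c\<close>.\<close>
  define k where "k = c / (1 + c)"
  have k: "0 < k" "k < 1" "k = (1 - k) * c" using g(2) by (auto simp: k_def field_simps)
  obtain h where h: "purchase_distribution h" and mix: "\<And>\<phi>. \<phi> \<in> borel_measurable borel \<Longrightarrow>
      (\<integral>\<^sup>+t. \<phi> t \<partial>h) = ennreal (1 - k) * (\<integral>\<^sup>+t. \<phi> t \<partial>g) + ennreal k * (\<integral>\<^sup>+t. \<phi> t \<partial>?d)"
    using mixture_exists[OF pg pd, of k] k by auto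
  have "feasible a \<gamma> \<delta> h" using k by (intro feasible_mixture[OF g(1) fd h _ _ mix]) auto
  moreover have "comp_ratio a h \<le> ennreal (1 + (1 - a) * ((1 - k) * r))"
    unfolding comp_ratio_def
  proof (rule SUP_least)
    fix x :: ennreal assume "x \<in> {0<..}"
    then have x: "0 < x" by simp
    show "alpha_avg a h x \<le> ennreal (1 + (1 - a) * ((1 - k) * r))"
    proof (cases x)
      case (real y)
      have y: "0 < y" using x real by (metis ennreal_0 less_le not_less_iff_gr_or_eq)
      have eq: "(\<integral>t. excess a t y \<partial>h) = (1 - k) * (\<integral>t. excess a t y \<partial>g) + k * excess a 1 y"
        using k excess_bounds[OF a(1) y] integral_mixture[OF pg pd h _ _ mix excess_measurable, of a y "1/y+y"]
        by (simp add: integral_return)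
      have "(\<integral>t. excess a t y \<partial>h) \<le> (1 - k) * r"
      proof (cases "y < 1")
        case True
        then have "excess a 1 y = 0" using y by (simp add: excess_def flip: ennreal_1)
        then show ?thesis using eq g(4)[OF y True] R[OF y] k by simp
      next
        case False
        then have y1: "1 \<le> y" by simp
        define b where "b = 1 - a + a * y"
        have b: "0 < b" using offline_cost_ge_one[OF a(1) y1] by (simp add: b_def)
        have "excess a 1 y = 1 / b"
          using y1 by (simp add: excess_eq_late_cost b_def late_cost_def flip: ennreal_1)
        moreover have "b * (\<integral>t. excess a t y \<partial>g) \<le> r * b - c"
          using g(3)[OF y1] late[OF y1, of g] by (simp add: b_def)
        then have "(1 - k) * (b * (\<integral>t. excess a t y \<partial>g)) \<le> (1 - k) * (r * b - c)"
          using k by (intro mult_left_mono) auto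
        ultimately have "b * (\<integral>t. excess a t y \<partial>h) \<le> (1 - k) * (r * b - c) + k"
          using b by (simp add: eq algebra_simps)
        also have "\<dots> = b * ((1 - k) * r)" using k(3) by (simp add: algebra_simps)
        finally show ?thesis using b by simp
      qed
      then show ?thesis
        unfolding real avg[OF h y] using a by (intro ennreal_leI add_left_mono mult_left_mono) auto
    next
      case top
      \<comment> \<open>This case stays in \<open>ennreal\<close>, because
        \<alpha>(\<infinity>,\<infinity>) is infinite for \<open>a = 0\<close>. The point mass
        contributes ratio 1, hence no excess.\<close>
      have "alpha_avg a h \<infinity> = ennreal (1 - k) * alpha_avg a g \<infinity> + ennreal k * alpha a 1 \<infinity>"
        by (simp add: alpha_avg_def mix nn_integral_return)
      also have "\<dots> \<le> ennreal (1 - k) * ennreal (1 + (1 - a) * r) + ennreal k"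
        using g(5) avg_le[of \<infinity>] V
        by (intro add_mono mult_left_mono) (auto simp: alpha_def)
      also have "\<dots> = ennreal ((1 - k) * (1 + (1 - a) * r) + k)"
        using k V0 by (simp add: ennreal_mult ennreal_plus)
      also have "(1 - k) * (1 + (1 - a) * r) + k = 1 + (1 - a) * ((1 - k) * r)"
        by (simp add: algebra_simps)
      finally show ?thesis using top by simp
    qed
  qed
  ultimately have "OPT a \<gamma> \<delta> \<le> ennreal (1 + (1 - a) * ((1 - k) * r))"
    using best[of h] by (meson order_trans)
  moreover have "1 + (1 - a) * ((1 - k) * r) < 1 + (1 - a) * r"
    using a k r by simp
  ultimately show False
    unfolding V using V0 by (subst (asm) ennreal_le_iff) (use a k r in \<open>auto intro!: add_nonneg_nonneg\<close>)
qed

end
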